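(* Let $n$ be a positive integer and let $R$ be a commutative ring with unity in which the zero ideal $0$ is $n$-absorbing. Then $(\sqrt{0})^{n} = 0$; that is, for all $a_1,\ldots,a_n \in \sqrt{0}$ one has $a_1 a_2\cdots a_n = 0$.
   Context: All rings are commutative with unity. For an ideal $I$, $\sqrt{I}$ denotes its radical; in particular $\sqrt{0}$ is the ideal of nilpotent elements of $R$. An ideal $I$ of a commutative ring $R$ is called $n$-absorbing if whenever $a_1,\ldots,a_{n+1}\in R$ satisfy $a_1\cdots a_{n+1}\in I$, there is some $i\in\{1,\ldots,n+1\}$ such that the product of the $n$ remaining elements $a_1\cdots a_{i-1}a_{i+1}\cdots a_{n+1}$ lies in $I$ (the ideal is not required to be proper). *)

theory Defs
  imports "HOL-Algebra.Ideal_Product"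
begin

definition ideal_radical :: "('a, 'b) ring_scheme \<Rightarrow> 'a set \<Rightarrow> 'a set" where
  "ideal_radical R I = {x \<in> carrier R. \<exists>k::nat. 0 < k \<and> x [^]\<^bsub>R\<^esub> k \<in> I}"

(* Properness of I is not required. *)
definition absorbing_ideal :: "nat \<Rightarrow> 'a set \<Rightarrow> ('a, 'b) ring_scheme \<Rightarrow> bool" where
  "absorbing_ideal n I R \<longleftrightarrow>
     ideal I R \<and>
     (\<forall>a \<in> {1..n + 1} \<rightarrow> carrier R.
        (\<Otimes>\<^bsub>R\<^esub>j\<in>{1..n + 1}. a j) \<in> I \<longrightarrow>
        (\<exists>i\<in>{1..n + 1}. (\<Otimes>\<^bsub>R\<^esub>j\<in>{1..n + 1} - {i}. a j) \<in> I))"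

(* The n-th power of an ideal is its n-th power in the multiplicative monoid
   of ideals_set R, that is, an iterated ideal product ideal_prod. *)
definition ideal_power :: "('a, 'b) ring_scheme \<Rightarrow> 'a set \<Rightarrow> nat \<Rightarrow> 'a set" where
  "ideal_power R I n = I [^]\<^bsub>ideals_set R\<^esub> n"

end

theory Submission
  imports Defs
begin

text \<open>
  The theorem is the case \<open>I = 0\<close> of \<open>(\<surd>I)\<^sup>n \<subseteq> I\<close> for an \<open>n\<close>-absorbing ideal \<open>I\<close>. Let
  \<open>x\<^sub>0, \<dots>, x\<^bsub>N-1\<^esub> \<in> \<surd>I\<close>. A monomial in the \<open>x\<^sub>i\<close> of large enough degree contains a high
  power of some \<open>x\<^sub>i\<close>, so it lies in \<open>I\<close>. It therefore suffices to descend one degree at a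
  time: if \<open>d \<ge> n\<close> and all monomials of degree \<open>d + 1\<close> lie in \<open>I\<close>, then so do all
  monomials of degree \<open>d\<close>. Once degree \<open>n\<close> is reached, \<open>x\<^sub>0 \<cdots> x\<^bsub>n-1\<^esub>\<close> itself is such a monomial.

  For the descent, suppose some monomial of degree \<open>d\<close> lies outside \<open>I\<close>, and among these
  choose \<open>m = x\<^bsub>f 0\<^esub> \<cdots> x\<^bsub>f (d-1)\<^esub>\<close> with the largest sum of indices. Write \<open>m\<^sub>j\<close> for
  \<open>m\<close> with its \<open>j\<close>-th factor removed. By maximality \<open>x\<^sub>t m\<^sub>j \<in> I\<close> whenever \<open>t > f j\<close>, while
  \<open>x\<^sub>t m\<^sub>j = m \<notin> I\<close> for \<open>t = f j\<close>. This triangular pattern makes it possible to choose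
  coefficients \<open>c\<^sub>0, c\<^sub>1, \<dots> \<in> {0, 1}\<close> one after the other such that \<open>y = \<Sum> c\<^sub>t x\<^sub>t\<close> satisfies
  \<open>y m\<^sub>j \<notin> I\<close> for every \<open>j\<close>: modulo \<open>I\<close>, adding \<open>x\<^sub>t\<close> does not change \<open>y m\<^sub>j\<close>
  for \<open>f j < t\<close>; the \<open>j\<close> with \<open>f j = t\<close> all have the same \<open>m\<^sub>j\<close>, and the two possible values
  of \<open>y m\<^sub>j\<close> for \<open>c\<^sub>t = 0\<close> and \<open>c\<^sub>t = 1\<close> differ by \<open>m \<notin> I\<close>, so they cannot both lie in \<open>I\<close>. Now
  \<open>y m \<in> I\<close> is a product of \<open>d + 1\<close> factors none of which can be dropped, because dropping
  \<open>y\<close> leaves \<open>m\<close> and dropping a factor of \<open>m\<close> leaves \<open>y m\<^sub>j\<close>. As \<open>d \<ge> n\<close>, this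
  contradicts the absorbing property.
\<close>

section \<open>Dropping a factor from a long product\<close>

lemma (in comm_monoid) finprod_remove:
  assumes "finite A" "i \<in> A" "a \<in> A \<rightarrow> carrier G"
  shows "finprod G a A = a i \<otimes> finprod G a (A - {i})"
proof -
  have "finprod G a (insert i (A - {i})) = a i \<otimes> finprod G a (A - {i})"
    using assms by (intro finprod_insert) auto
  then show ?thesis
    using assms(2) by (simp add: insert_absorb)
qed

text \<open>
  An \<open>n\<close>-absorbing ideal is \<open>d\<close>-absorbing for every \<open>d \<ge> n\<close>: in a product of more than
  \<open>n + 1\<close> factors two of them can be merged into one, and if the factor that gets dropped is
  the merged one, either half can be multiplied back in.
\<close>

lemma (in cring) absorbing_ideal_drop_factor:
  assumes abs: "absorbing_ideal n I R"
    and "n < card A" and "a \<in> A \<rightarrow> carrier R" and "finprod R a A \<in> I"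
  shows "\<exists>i\<in>A. finprod R a (A - {i}) \<in> I"
  using assms(2-)
proof (induction "card A - Suc n" arbitrary: A a)
  case 0
  interpret ideal I R
    using abs by (simp add: absorbing_ideal_def)
  have cA: "card A = n + 1" and fin: "finite A"
    using 0 by (auto intro: card_ge_0_finite)
  obtain h where h: "bij_betw h {1..n + 1} A"
    using finite_same_card_bij[of "{1..n + 1}" A] cA fin by auto
  have inj: "inj_on h {1..n + 1}" and im: "h ` {1..n + 1} = A"
    using h by (auto simp: bij_betw_def)
  have reindex: "(\<Otimes>j\<in>B. a (h j)) = finprod R a (h ` B)" if "B \<subseteq> {1..n + 1}" for B
    using that 0(3) im inj by (intro finprod_reindex [symmetric]) (auto intro: inj_on_subset)
  have "(\<Otimes>j\<in>{1..n + 1}. a (h j)) \<in> I"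
    using 0(4) reindex[of "{1..n + 1}"] im by simp
  moreover have "(\<lambda>j. a (h j)) \<in> {1..n + 1} \<rightarrow> carrier R"
    using 0(3) im by auto
  ultimately obtain i where i: "i \<in> {1..n + 1}" "(\<Otimes>j\<in>{1..n + 1} - {i}. a (h j)) \<in> I"
    using abs unfolding absorbing_ideal_def by blast
  have "h ` ({1..n + 1} - {i}) = A - {h i}"
    using inj im i(1) by (auto simp: inj_on_def)
  then have "finprod R a (A - {h i}) \<in> I"
    using i reindex[of "{1..n + 1} - {i}"] by simp
  then show ?case
    using i(1) im by blast
next
  case (Suc k)
  interpret ideal I R
    using abs by (simp add: absorbing_ideal_def)
  have fin: "finite A"
    using Suc.prems(1) by (auto intro: card_ge_0_finite)
  have "card A \<ge> 2"
    using Suc by linarith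
  then obtain p q where pq: "p \<in> A" "q \<in> A" "p \<noteq> q"
    by (metis One_nat_def Suc_1 card_le_Suc0_iff_eq fin not_less_eq_eq)
  define b where "b = a(q := a p \<otimes> a q)"
  have car [simp]: "a i \<in> carrier R" if "i \<in> A" for i
    using Suc.prems(2) that by auto
  have merge: "finprod R b (B - {p}) = finprod R a B" if "B \<subseteq> A" "p \<in> B" "q \<in> B" for B
  proof -
    have finB: "finite B"
      using that(1) fin finite_subset by blast
    have aB: "a \<in> B \<rightarrow> carrier R"
      using that by auto
    then have aBp: "a \<in> B - {p} \<rightarrow> carrier R"
      by auto
    have rest: "finprod R b (B - {p} - {q}) = finprod R a (B - {p} - {q})"
      using that by (intro finprod_cong') (auto simp: b_def)
    have cl: "finprod R a (B - {p} - {q}) \<in> carrier R"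
      using that by (intro finprod_closed) auto
    have "b \<in> B - {p} \<rightarrow> carrier R"
      using that pq by (auto simp: b_def subset_iff)
    then have "finprod R b (B - {p}) = (a p \<otimes> a q) \<otimes> finprod R a (B - {p} - {q})"
      using that finB pq finprod_remove[of "B - {p}" q b] rest by (simp add: b_def)
    also have "\<dots> = a p \<otimes> finprod R a (B - {p})"
      using that finB pq cl finprod_remove[OF _ _ aBp, of q] by (simp add: m_assoc)
    also have "\<dots> = finprod R a B"
      using that finB finprod_remove[OF _ _ aB, of p] by simp
    finally show ?thesis .
  qed
  have "k = card (A - {p}) - Suc n" "n < card (A - {p})"
    using Suc.hyps(2) pq fin by auto
  moreover have "b \<in> A - {p} \<rightarrow> carrier R"
    using pq by (auto simp: b_def)
  moreover have "finprod R b (A - {p}) \<in> I"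
    using merge[of A] pq Suc.prems(3) by simp
  ultimately obtain i where i: "i \<in> A - {p}" "finprod R b (A - {p} - {i}) \<in> I"
    using Suc.hyps(1) by blast
  show ?case
  proof (cases "i = q")
    case True
    have "finprod R b (A - {p} - {q}) = finprod R a (A - {p} - {q})"
      using pq by (intro finprod_cong') (auto simp: b_def)
    then have "a q \<otimes> finprod R a (A - {p} - {q}) \<in> I"
      using i True pq by (simp add: I_l_closed)
    then have "finprod R a (A - {p}) \<in> I"
      using finprod_remove[of "A - {p}" q a] fin pq by auto
    then show ?thesis
      using pq by blast
  next
    case False
    then have "finprod R b (A - {i} - {p}) = finprod R a (A - {i})"
      using i pq by (intro merge) auto
    moreover have "A - {i} - {p} = A - {p} - {i}"
      by blast
    ultimately have "finprod R a (A - {i}) \<in> I"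
      using i(2) by metis
    then show ?thesis
      using i by blast
  qed
qed

section \<open>Monomials in elements of the radical\<close>

text \<open>
  Monomials are encoded by the function \<open>f\<close> that lists the indices of their factors, so that
  replacing a factor is a function update. In a list of \<open>N * K\<close> indices below \<open>N\<close> some index
  occurs \<open>K\<close> times.
\<close>

lemma (in cring) high_degree_monomial_in_ideal:
  fixes N K :: nat
  assumes "ideal I R"
    and x: "x \<in> {..<N} \<rightarrow> carrier R" and pow: "\<And>l. l < N \<Longrightarrow> x l [^] K \<in> I"
    and "N > 0" and f: "f \<in> {..<N * K} \<rightarrow> {..<N}"
  shows "(\<Otimes>j\<in>{..<N * K}. x (f j)) \<in> I"
proof -
  interpret ideal I R by fact
  let ?D = "{..<N * K}"
  obtain l where l: "l < N" "card (f -` {l} \<inter> ?D) \<ge> K"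
    using pigeonhole_card[OF f] \<open>N > 0\<close>
    by (auto simp: lessThan_empty_iff)
  obtain B where B: "B \<subseteq> f -` {l} \<inter> ?D" "card B = K" "finite B"
    using l(2) by (meson obtain_subset_with_card_n)
  have car: "(\<lambda>j. x (f j)) \<in> ?D \<rightarrow> carrier R"
    using x f by auto
  have "finprod R (\<lambda>j. x (f j)) (B \<union> (?D - B))
      = finprod R (\<lambda>j. x (f j)) B \<otimes> finprod R (\<lambda>j. x (f j)) (?D - B)"
    using B car by (intro finprod_Un_disjoint) auto
  moreover have "B \<union> (?D - B) = ?D"
    using B by auto
  moreover have "finprod R (\<lambda>j. x (f j)) B = finprod R (\<lambda>j. x l) B"
    using B x l by (intro finprod_cong') auto
  then have "finprod R (\<lambda>j. x (f j)) B = x l [^] K"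
    using B x l by (simp add: finprod_const Pi_iff)
  moreover have "finprod R (\<lambda>j. x (f j)) (?D - B) \<in> carrier R"
    using car by (intro finprod_closed) auto
  ultimately show ?thesis
    using pow[OF l(1)] by (simp add: I_r_closed)
qed

text \<open>
  A monomial of degree \<open>d\<close> outside \<open>I\<close> with the largest possible sum of indices would lead to a
  linear form \<open>y\<close> such that \<open>y\<close> times the monomial contradicts the absorbing property. In the
  proof this monomial is \<open>P f\<close>, and \<open>Q j\<close> is \<open>P f\<close> without its factor in position \<open>j\<close>.
\<close>

lemma (in cring) absorbing_ideal_monomial_descent:
  fixes N :: nat
  assumes abs: "absorbing_ideal n I R" and "n \<le> d"
    and x: "x \<in> {..<N} \<rightarrow> carrier R"
    and up: "\<And>f. f \<in> {..<Suc d} \<rightarrow> {..<N} \<Longrightarrow> (\<Otimes>j\<in>{..<Suc d}. x (f j)) \<in> I"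
    and g: "g \<in> {..<d} \<rightarrow> {..<N}"
  shows "(\<Otimes>j\<in>{..<d}. x (g j)) \<in> I"
proof (rule ccontr)
  assume g_notin: "(\<Otimes>j\<in>{..<d}. x (g j)) \<notin> I"
  interpret ideal I R
    using abs by (simp add: absorbing_ideal_def)
  define P where "P f = (\<Otimes>j\<in>{..<d}. x (f j))" for f
  define bad where "bad f \<longleftrightarrow> f \<in> {..<d} \<rightarrow> {..<N} \<and> P f \<notin> I" for f
  have bounded: "(\<Sum>j<d. f j) < Suc (d * N)" if "bad f" for f
    using that sum_bounded_above[of "{..<d}" f N]
    by (auto simp: bad_def Pi_iff less_Suc_eq_le less_imp_le)
  have "bad g"
    using g g_notin by (simp add: bad_def P_def)
  then obtain f where "bad f" and f_max: "\<And>h. bad h \<Longrightarrow> (\<Sum>j<d. h j) \<le> (\<Sum>j<d. f j)"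
    using ex_has_greatest_nat[of bad g "\<lambda>f. \<Sum>j<d. f j"] bounded by blast
  have f: "f \<in> {..<d} \<rightarrow> {..<N}" and m_notin: "P f \<notin> I"
    using \<open>bad f\<close> by (auto simp: bad_def)
  have xf [simp]: "x (f j) \<in> carrier R" if "j < d" for j
    using x f that by (auto simp: Pi_iff)
  have xt [simp]: "x t \<in> carrier R" if "t < N" for t
    using x that by auto
  have P_closed [simp]: "P f \<in> carrier R"
    unfolding P_def by (intro finprod_closed) auto
  define Q where "Q j = (\<Otimes>i\<in>{..<d} - {j}. x (f i))" for j
  have Q_closed [simp]: "Q j \<in> carrier R" for j
    unfolding Q_def by (intro finprod_closed) auto
  have xQ_upd: "x t \<otimes> Q j = P (f(j := t))" if "j < d" "t < N" for j t
  proof -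
    have "P (f(j := t)) = x t \<otimes> (\<Otimes>i\<in>{..<d} - {j}. x ((f(j := t)) i))"
      using that finprod_remove[of "{..<d}" j "\<lambda>i. x ((f(j := t)) i)"] by (auto simp: P_def)
    also have "(\<Otimes>i\<in>{..<d} - {j}. x ((f(j := t)) i)) = Q j"
      unfolding Q_def by (intro finprod_cong') auto
    finally show ?thesis ..
  qed
  have xQ_above: "x t \<otimes> Q j \<in> I" if "j < d" "t < N" "f j < t" for j t
  proof (rule ccontr)
    assume "x t \<otimes> Q j \<notin> I"
    then have "bad (f(j := t))"
      using that f xQ_upd by (auto simp: bad_def)
    then have "(\<Sum>i<d. (f(j := t)) i) \<le> (\<Sum>i<d. f i)"
      by (rule f_max)
    moreover have "(\<Sum>i<d. f i) < (\<Sum>i<d. (f(j := t)) i)"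
      using that by (intro sum_strict_mono_ex1) auto
    ultimately show False
      by simp
  qed
  have xQ_diag: "x (f j) \<otimes> Q j = P f" if "j < d" for j
    using xQ_upd[of j "f j"] that f by (auto simp: Pi_iff)
  have Q_eq: "Q i = Q j" if "i < d" "j < d" "f i = f j" for i j
  proof (cases "i = j")
    case False
    have "{..<d} - {j} - {i} = {..<d} - {i} - {j}"
      by blast
    then show ?thesis
      using that False finprod_remove[of "{..<d} - {i}" j "\<lambda>l. x (f l)"]
        finprod_remove[of "{..<d} - {j}" i "\<lambda>l. x (f l)"]
      by (auto simp: Q_def)
  qed simp
  have xP: "x t \<otimes> P f \<in> I" if "t < N" for t
  proof -
    have "(\<Otimes>j\<in>{..<Suc d}. x ((f(d := t)) j)) = x t \<otimes> P f"
    proof -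
      have "(\<Otimes>j\<in>{..<d}. x ((f(d := t)) j)) = P f"
        unfolding P_def by (intro finprod_cong') auto
      then show ?thesis
        using that by (simp add: lessThan_Suc Pi_iff)
    qed
    moreover have "f(d := t) \<in> {..<Suc d} \<rightarrow> {..<N}"
      using f that by (auto simp: less_Suc_eq Pi_iff)
    ultimately show ?thesis
      using up by metis
  qed
  \<comment> \<open>The witness is the partial sum \<open>c\<^sub>0 x\<^sub>0 + \<dots> + c\<^bsub>t-1\<^esub> x\<^bsub>t-1\<^esub>\<close>; of its shape only these properties matter.\<close>
  have "\<exists>y\<in>carrier R. y \<otimes> P f \<in> I \<and> (\<forall>j<d. f j < t \<longrightarrow> y \<otimes> Q j \<notin> I)" if "t \<le> N" for t
    using that
  proof (induction t)
    case 0
    show ?case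
      by (intro bexI[of _ \<zero>]) auto
  next
    case (Suc t)
    then obtain y where y: "y \<in> carrier R" "y \<otimes> P f \<in> I"
      and yQ: "\<And>j. j < d \<Longrightarrow> f j < t \<Longrightarrow> y \<otimes> Q j \<notin> I"
      by auto
    have t: "t < N"
      using Suc.prems by simp
    show ?case
    proof (cases "\<exists>j<d. f j = t \<and> y \<otimes> Q j \<in> I")
      case False
      then show ?thesis
        using y yQ by (auto simp: less_Suc_eq)
    next
      case True
      then obtain i where i: "i < d" "f i = t" "y \<otimes> Q i \<in> I"
        by blast
      have cancel: "b \<in> I" if "a \<oplus> b \<in> I" "a \<in> I" "b \<in> carrier R" for a b
      proof -
        have "\<ominus> a \<oplus> (a \<oplus> b) = b"
          using that Icarr by (simp add: r_neg1)
        then show ?thesis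
          using that by (metis a_closed a_inv_closed)
      qed
      have "(y \<oplus> x t) \<otimes> Q j \<notin> I" if "j < d" "f j < Suc t" for j
      proof
        assume "(y \<oplus> x t) \<otimes> Q j \<in> I"
        then have *: "y \<otimes> Q j \<oplus> x t \<otimes> Q j \<in> I"
          using y t by (simp add: l_distr)
        show False
        proof (cases "f j = t")
          case True
          then have "Q j = Q i"
            using Q_eq[OF that(1) i(1)] i(2) by simp
          then have "x t \<otimes> Q j \<in> I"
            using cancel[OF *] i t by simp
          then show False
            using True xQ_diag[OF that(1)] m_notin by simp
        next
          case False
          then have "f j < t"
            using that by simp
          moreover have "y \<otimes> Q j \<in> I"
            using cancel[of "x t \<otimes> Q j" "y \<otimes> Q j"] * xQ_above[OF that(1) t \<open>f j < t\<close>] y t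
            by (simp add: a_comm)
          ultimately show False
            using yQ that by blast
        qed
      qed
      moreover have "(y \<oplus> x t) \<otimes> P f \<in> I"
        using y t xP[OF t] by (simp add: l_distr)
      ultimately show ?thesis
        using y t by (intro bexI[of _ "y \<oplus> x t"]) auto
    qed
  qed
  from this[of N] f obtain y where y: "y \<in> carrier R" "y \<otimes> P f \<in> I"
    and yQ: "\<And>j. j < d \<Longrightarrow> y \<otimes> Q j \<notin> I"
    by (auto simp: Pi_iff)
  \<comment> \<open>The product \<open>y m\<close> with \<open>y\<close> as the factor in position \<open>d\<close>; none of its factors can be dropped.\<close>
  define a where "a = (\<lambda>j. x (f j))(d := y)"
  have a_car: "a \<in> {..<Suc d} \<rightarrow> carrier R"
    using y by (auto simp: a_def less_Suc_eq)
  have a_prod: "finprod R a (insert d B) = y \<otimes> (\<Otimes>j\<in>B. x (f j))" if "B \<subseteq> {..<d}" for B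
  proof -
    have "finprod R a B = (\<Otimes>j\<in>B. x (f j))"
      using that by (intro finprod_cong') (auto simp: a_def)
    then show ?thesis
      using that y a_car finite_subset[OF that]
      by (subst finprod_insert) (auto simp: a_def Pi_iff)
  qed
  have "finprod R a {..<Suc d} \<in> I"
    using a_prod[of "{..<d}"] y by (simp add: P_def lessThan_Suc)
  then obtain i where i: "i < Suc d" "finprod R a ({..<Suc d} - {i}) \<in> I"
    using absorbing_ideal_drop_factor[OF abs _ a_car] \<open>n \<le> d\<close> by auto
  show False
  proof (cases "i = d")
    case True
    have "finprod R a ({..<Suc d} - {d}) = P f"
      unfolding P_def by (intro finprod_cong') (auto simp: a_def less_Suc_eq)
    then show False
      using i True m_notin by simp
  next
    case False
    then have "{..<Suc d} - {i} = insert d ({..<d} - {i})" "i < d"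
      using i by auto
    then show False
      using i a_prod[of "{..<d} - {i}"] yQ by (auto simp: Q_def)
  qed
qed

text \<open>
  The product is itself one of the monomials of degree \<open>n\<close>, the degree at which the descent ends.
\<close>

lemma (in cring) absorbing_ideal_prod_radical:
  assumes abs: "absorbing_ideal n I R" and "n \<ge> 1"
    and x: "x \<in> {..<n} \<rightarrow> ideal_radical R I"
  shows "(\<Otimes>j\<in>{..<n}. x j) \<in> I"
proof -
  interpret ideal I R
    using abs by (simp add: absorbing_ideal_def)
  have x_car: "x \<in> {..<n} \<rightarrow> carrier R"
    using x by (auto simp: ideal_radical_def)
  have "\<forall>l<n. \<exists>k. x l [^] (k::nat) \<in> I"
    using x by (auto simp: ideal_radical_def)
  then obtain k :: "nat \<Rightarrow> nat" where k: "\<And>l. l < n \<Longrightarrow> x l [^] k l \<in> I"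
    by metis
  \<comment> \<open>A common exponent; the successor makes \<open>n * K\<close> a degree that is at least \<open>n\<close>.\<close>
  define K where "K = Suc (\<Sum>l<n. k l)"
  have pow: "x l [^] K \<in> I" if "l < n" for l
  proof -
    have "k l \<le> K"
      using that member_le_sum[of l "{..<n}" k] by (simp add: K_def)
    then have "x l [^] K = x l [^] k l \<otimes> x l [^] (K - k l)"
      using that x_car by (subst nat_pow_mult) auto
    then show ?thesis
      using that k x_car by (auto intro!: I_r_closed)
  qed
  \<comment> \<open>The definition hides the number \<open>n\<close> of the elements \<open>x l\<close> from the induction, in which
    only the degree may vary.\<close>
  define monomials_in where
    "monomials_in d \<longleftrightarrow> (\<forall>f\<in>{..<d} \<rightarrow> {..<n}. (\<Otimes>j\<in>{..<d}. x (f j)) \<in> I)" for d :: nat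
  have "n \<le> n * K"
    by (simp add: K_def)
  then have "monomials_in n"
  proof (induction rule: inc_induct)
    case base
    show ?case
      using high_degree_monomial_in_ideal[OF is_ideal x_car pow] \<open>n \<ge> 1\<close> by (simp add: monomials_in_def)
  next
    case (step d)
    then show ?case
      unfolding monomials_in_def using absorbing_ideal_monomial_descent[OF abs _ x_car] by blast
  qed
  then show ?thesis
    by (auto simp: monomials_in_def dest: bspec[of _ _ "\<lambda>j. j"])
qed

section \<open>Powers of the radical\<close>

text \<open>
  An element of the \<open>k\<close>-th power of \<open>J\<close> is a sum of products. Carrying along the remaining
  \<open>n - k\<close> factors turns the claim into one that passes through sums and through the inductive
  definition of the product of ideals.
\<close>

lemma (in cring) ideal_power_subset:
  assumes "ideal I R" and J: "J \<subseteq> carrier R"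
    and prod: "\<And>a. a \<in> {..<n} \<rightarrow> J \<Longrightarrow> (\<Otimes>j\<in>{..<n}. a j) \<in> I"
  shows "ideal_power R J n \<subseteq> I"
proof -
  interpret ideal I R by fact
  have power_0: "ideal_power R J 0 = carrier R"
    and power_Suc: "ideal_power R J (Suc k) = ideal_prod R (ideal_power R J k) J" for k
    by (simp_all add: ideal_power_def nat_pow_def ideals_set_def)
  have main: "s \<in> carrier R \<and> (\<forall>a\<in>{..<m} \<rightarrow> J. s \<otimes> (\<Otimes>j\<in>{..<m}. a j) \<in> I)"
    if "k + m = n" "s \<in> ideal_power R J k" for k m s
    using that
  proof (induction k arbitrary: m s)
    case 0
    then show ?case
      using prod by (auto simp: power_0 intro!: I_l_closed)
  next
    case (Suc k)
    have IH: "s \<in> carrier R \<and> (\<forall>a\<in>{..<Suc m} \<rightarrow> J. s \<otimes> (\<Otimes>j\<in>{..<Suc m}. a j) \<in> I)"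
      if "s \<in> ideal_power R J k" for s
      using Suc.IH[of "Suc m" s] Suc.prems(1) that by simp
    show ?case
      using Suc.prems(2) unfolding power_Suc
    proof (induction rule: ideal_prod.induct)
      case (prod s b)
      have "s \<otimes> b \<otimes> (\<Otimes>j\<in>{..<m}. a j) \<in> I" if a: "a \<in> {..<m} \<rightarrow> J" for a
      proof -
        have b: "b \<in> carrier R" and a_car: "a \<in> {..<m} \<rightarrow> carrier R"
          using prod a J by auto
        have "(\<Otimes>j\<in>{..<m}. (a(m := b)) j) = (\<Otimes>j\<in>{..<m}. a j)"
          using a_car by (intro finprod_cong') auto
        then have "(\<Otimes>j\<in>{..<Suc m}. (a(m := b)) j) = b \<otimes> (\<Otimes>j\<in>{..<m}. a j)"
          using a_car b by (simp add: lessThan_Suc Pi_iff)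
        moreover have "a(m := b) \<in> {..<Suc m} \<rightarrow> J"
          using a prod by (auto simp: less_Suc_eq Pi_iff)
        ultimately have "s \<otimes> (b \<otimes> (\<Otimes>j\<in>{..<m}. a j)) \<in> I"
          using IH[OF prod(1)] by metis
        then show ?thesis
          using IH[OF prod(1)] a_car b by (simp add: m_assoc)
      qed
      then show ?case
        using IH[OF prod(1)] prod(2) J by auto
    next
      case (sum s1 s2)
      have "(s1 \<oplus> s2) \<otimes> (\<Otimes>j\<in>{..<m}. a j) \<in> I" if a: "a \<in> {..<m} \<rightarrow> J" for a
      proof -
        have "(\<Otimes>j\<in>{..<m}. a j) \<in> carrier R"
          using a J by (intro finprod_closed) auto
        then show ?thesis
          using sum a by (simp add: l_distr)
      qed
      then show ?case
        using sum by auto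
    qed
  qed
  show ?thesis
  proof
    fix s
    assume "s \<in> ideal_power R J n"
    then have "s \<in> carrier R" "s \<otimes> \<one> \<in> I"
      using main[of n 0 s] by auto
    then show "s \<in> I"
      by simp
  qed
qed

lemma (in cring) zero_in_ideal_power:
  assumes "\<zero> \<in> J"
  shows "\<zero> \<in> ideal_power R J n"
proof (induction n)
  case 0
  show ?case
    by (simp add: ideal_power_def nat_pow_def ideals_set_def)
next
  case (Suc n)
  then have "\<zero> \<otimes> \<zero> \<in> ideal_prod R (ideal_power R J n) J"
    using assms by (intro ideal_prod.prod)
  then show ?case
    by (simp add: ideal_power_def nat_pow_def ideals_set_def)
qed

theorem theorem1:
  fixes R :: "('a, 'b) ring_scheme" and n :: nat
  assumes "cring R"
    and "n \<ge> 1"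
    and "absorbing_ideal n {\<zero>\<^bsub>R\<^esub>} R"
  shows "ideal_power R (ideal_radical R {\<zero>\<^bsub>R\<^esub>}) n = {\<zero>\<^bsub>R\<^esub>} \<and>
    (\<forall>a \<in> {1..n} \<rightarrow> ideal_radical R {\<zero>\<^bsub>R\<^esub>}. (\<Otimes>\<^bsub>R\<^esub>i\<in>{1..n}. a i) = \<zero>\<^bsub>R\<^esub>)"
proof -
  interpret cring R by fact
  let ?J = "ideal_radical R {\<zero>\<^bsub>R\<^esub>}"
  have J: "?J \<subseteq> carrier R"
    by (auto simp: ideal_radical_def)
  have prod: "(\<Otimes>\<^bsub>R\<^esub>j\<in>{..<n}. a j) \<in> {\<zero>\<^bsub>R\<^esub>}" if "a \<in> {..<n} \<rightarrow> ?J" for a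
    using absorbing_ideal_prod_radical assms(2,3) that by blast
  have "\<zero>\<^bsub>R\<^esub> [^]\<^bsub>R\<^esub> (1::nat) = \<zero>\<^bsub>R\<^esub>"
    by simp
  then have "\<zero>\<^bsub>R\<^esub> \<in> ?J"
    unfolding ideal_radical_def by blast
  then have "ideal_power R ?J n = {\<zero>\<^bsub>R\<^esub>}"
    using ideal_power_subset[OF zeroideal J prod] zero_in_ideal_power by blast
  moreover have "(\<Otimes>\<^bsub>R\<^esub>i\<in>{1..n}. a i) = \<zero>\<^bsub>R\<^esub>" if a: "a \<in> {1..n} \<rightarrow> ?J" for a
  proof -
    have "Suc ` {..<n} = {1..n}"
      by (simp add: image_Suc_lessThan)
    then have "(\<Otimes>\<^bsub>R\<^esub>i\<in>{1..n}. a i) = (\<Otimes>\<^bsub>R\<^esub>j\<in>{..<n}. a (Suc j))"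
      using finprod_reindex[of a Suc "{..<n}"] a J by auto
    moreover have "(\<lambda>j. a (Suc j)) \<in> {..<n} \<rightarrow> ?J"
      using a by (auto simp: Pi_iff)
    then have "(\<Otimes>\<^bsub>R\<^esub>j\<in>{..<n}. a (Suc j)) = \<zero>\<^bsub>R\<^esub>"
      using prod by blast
    ultimately show ?thesis
      by simp
  qed
  ultimately show ?thesis
    by blast
qed

end
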